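(* Let $f\in C(K)$ and let $F_n^{(\alpha,\beta)}$ be the multivariate Stancu-type neural network operators. Then for every $\mathbf{s}\in K$ and every $n\in\mathbb{N}$ the value $F_n^{(\alpha,\beta)}(f;\mathbf{s})$ is well defined (its denominator is nonzero) and satisfies $$|F_n^{(\alpha,\beta)}(f;\mathbf{s})|\le\left(\frac{\mathcal{M}_0(\sigma_\eta)}{\sigma_\eta(1)}\right)^d\|f\|_\infty .$$
   Context: Sigmoidal function. A measurable function $\eta:\mathbb{R}\to\mathbb{R}$ is sigmoidal if $\lim_{s\to-\infty}\eta(s)=0$ and $\lim_{s\to+\infty}\eta(s)=1$. Throughout, $\eta$ is an increasing sigmoidal function with $\eta(1)<1$ such that: (a) $\eta(s)-\tfrac12$ is an odd function of $s$; (b) $\eta\in C^2(\mathbb{R})$ and $\eta$ is concave on $[0,+\infty)$; (c) there exists $\rho>0$ such that $\eta(s)=\mathcal{O}(|s|^{-1-\rho})$ as $s\to-\infty$. Activation functions. Put $\sigma_\eta(s):=\frac12[\eta(s+1)-\eta(s-1)]$ for $s\in\mathbb{R}$, and $\sigma(\mathbf{s})=\prod_{i=1}^d\sigma_\eta(s_i)$ for $\mathbf{s}=(s_1,\dots,s_d)\in\mathbb{R}^d$, $d\ge1$. The discrete absolute moment of order $0$ is $\mathcal{M}_0(\sigma_\eta):=\sup_{s\in\mathbb{R}}\sum_{k\in\mathbb{Z}}|\sigma_\eta(s-k)|$. Operators. Let $K=\prod_{i=1}^d[a_i,b_i]\subset\mathbb{R}^d$ be a compact rectangular domain, and let $0\le\alpha\le\beta$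 be fixed. For $n\in\mathbb{N}$ put $\Lambda_n=\{\mathbf{k}=(k_1,\dots,k_d)\in\mathbb{Z}^d:\lceil na_i\rceil\le k_i\le\lfloor nb_i\rfloor,\ i=1,\dots,d\}$, and for $\mathbf{k}\in\Lambda_n$ put $$\mathbf{s}_{\mathbf{k},n}^{\alpha,\beta}=\left(\frac{k_1+\alpha}{n+\beta},\dots,\frac{k_d+\alpha}{n+\beta}\right).$$ $C(K)$ is the space of real-valued continuous functions on $K$. For $f\in C(K)$, the multivariate Stancu-type neural network operators are $$F_n^{(\alpha,\beta)}(f;\mathbf{s})=\frac{\sum_{\mathbf{k}\in\Lambda_n}\sigma(n\mathbf{s}-\mathbf{k})\,f(\mathbf{s}_{\mathbf{k},n}^{\alpha,\beta})}{\sum_{\mathbf{k}\in\Lambda_n}\sigma(n\mathbf{s}-\mathbf{k})},\qquad\mathbf{s}\in K.$$ Convention. Since the nodes $\mathbf{s}_{\mathbf{k},n}^{\alpha,\beta}$ may lie outside $K$, whenever $f\in C(K)$ appears in the operators one fixes a bounded continuous extension of $f$ to a neighbourhood $U$ of $K$ containing all the nodes that occur, and this extension is still denoted by $f$. Here $\|f\|_\infty$ is the supremum of $|f|$ over $U$ (i.e. the uniform norm of the extended function).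
   Formalization: The formal theorem additionally assumes that the index set Λ_n is nonempty; without this the denominator is an empty sum equal to 0 (e.g. d=1, K=[0.1,0.9], n=1), so the claim for every n fails. *)

theory Defs
  imports "HOL-Analysis.Analysis" "HOL-Library.Landau_Symbols"
begin

definition sigmoidal :: "(real \<Rightarrow> real) \<Rightarrow> bool" where
  "sigmoidal \<eta> \<longleftrightarrow>
     \<eta> \<in> borel_measurable borel \<and> (\<eta> \<longlongrightarrow> 0) at_bot \<and> (\<eta> \<longlongrightarrow> 1) at_top"

definition C2_real :: "(real \<Rightarrow> real) \<Rightarrow> bool" where
  "C2_real g \<longleftrightarrow>
     (\<exists>g' g''. (\<forall>x. (g has_real_derivative g' x) (at x)) \<and>
               (\<forall>x. (g' has_real_derivative g'' x) (at x)) \<and>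
               continuous_on UNIV g'')"

(* "Increasing" is read in the weak sense: for a strictly increasing sigmoidal function
   the requirement \<eta> 1 < 1 would be redundant. *)
definition admissible_sigmoidal :: "(real \<Rightarrow> real) \<Rightarrow> bool" where
  "admissible_sigmoidal \<eta> \<longleftrightarrow>
     sigmoidal \<eta> \<and> mono \<eta> \<and> \<eta> 1 < 1 \<and>
     (\<forall>s. \<eta> (- s) - 1 / 2 = - (\<eta> s - 1 / 2)) \<and>
     C2_real \<eta> \<and> concave_on {0..} \<eta> \<and>
     (\<exists>\<rho>>0. \<eta> \<in> O[at_bot](\<lambda>s. \<bar>s\<bar> powr (- 1 - \<rho>)))"

definition activation :: "(real \<Rightarrow> real) \<Rightarrow> real \<Rightarrow> real" where
  "activation \<eta> s = (\<eta> (s + 1) - \<eta> (s - 1)) / 2"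

definition activation_prod :: "(real \<Rightarrow> real) \<Rightarrow> real ^ 'd \<Rightarrow> real" where
  "activation_prod \<eta> s = (\<Prod>i\<in>UNIV. activation \<eta> (s $ i))"

(* For an activation built from an admissible sigmoidal function the series converge and are
   uniformly bounded, so the conventions for undefined infinite sums and suprema of reals
   play no role. *)
definition discrete_moment0 :: "(real \<Rightarrow> real) \<Rightarrow> real" where
  "discrete_moment0 \<phi> = (SUP s. \<Sum>\<^sub>\<infinity>k::int. \<bar>\<phi> (s - of_int k)\<bar>)"

(* For small n this set can be empty (e.g. n = 1 and the interval [1/10, 9/10]); the denominator
   of the operator is then an empty sum, so the operator is defined only for nonempty index sets. *)
definition grid_index :: "real ^ 'd \<Rightarrow> real ^ 'd \<Rightarrow> nat \<Rightarrow> (int ^ 'd) set" where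
  "grid_index a b n = {k. \<forall>i. \<lceil>real n * a $ i\<rceil> \<le> k $ i \<and> k $ i \<le> \<lfloor>real n * b $ i\<rfloor>}"

definition stancu_node :: "real \<Rightarrow> real \<Rightarrow> nat \<Rightarrow> int ^ 'd \<Rightarrow> real ^ 'd" where
  "stancu_node \<alpha> \<beta> n k = (\<chi> i. (of_int (k $ i) + \<alpha>) / (real n + \<beta>))"

definition kernel :: "(real \<Rightarrow> real) \<Rightarrow> nat \<Rightarrow> real ^ 'd \<Rightarrow> int ^ 'd \<Rightarrow> real" where
  "kernel \<eta> n s k = activation_prod \<eta> (real n *\<^sub>R s - (\<chi> i. of_int (k $ i)))"

definition stancu_denom ::
    "(real \<Rightarrow> real) \<Rightarrow> real ^ 'd \<Rightarrow> real ^ 'd \<Rightarrow> nat \<Rightarrow> real ^ 'd \<Rightarrow> real" where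
  "stancu_denom \<eta> a b n s = (\<Sum>k\<in>grid_index a b n. kernel \<eta> n s k)"

definition stancu_op ::
    "(real \<Rightarrow> real) \<Rightarrow> real ^ 'd \<Rightarrow> real ^ 'd \<Rightarrow> real \<Rightarrow> real \<Rightarrow> nat \<Rightarrow>
      (real ^ 'd \<Rightarrow> real) \<Rightarrow> real ^ 'd \<Rightarrow> real" where
  "stancu_op \<eta> a b \<alpha> \<beta> n f s =
     (\<Sum>k\<in>grid_index a b n. kernel \<eta> n s k * f (stancu_node \<alpha> \<beta> n k)) /
     stancu_denom \<eta> a b n s"

(* f is the bounded continuous extension to a neighbourhood U of the rectangle cbox a b that
   contains the nodes of all operators; only its values on U matter. *)
definition bounded_cont_extension ::
    "real ^ 'd \<Rightarrow> real ^ 'd \<Rightarrow> real \<Rightarrow> real \<Rightarrow> (real ^ 'd) set \<Rightarrow> (real ^ 'd \<Rightarrow> real) \<Rightarrow> bool" where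
  "bounded_cont_extension a b \<alpha> \<beta> U f \<longleftrightarrow>
     cbox a b \<subseteq> interior U \<and>
     (\<forall>n\<ge>1. \<forall>k\<in>grid_index a b n. stancu_node \<alpha> \<beta> n k \<in> U) \<and>
     continuous_on U f \<and> bounded (f ` U)"

end

theory Submission
  imports Defs
begin

text \<open>
  The kernel is nonnegative, so wherever the denominator is positive the operator is an average of
  values of \<open>f\<close> on \<open>U\<close>, bounded by \<open>\<parallel>f\<parallel>\<^sub>\<infinity>\<close>. Some node lies within distance one of \<open>n s\<close> in each
  coordinate, and concavity makes the activation at least its value at 1 on \<open>[-1, 1]\<close>, so the
  denominator is positive. It remains to see that the constant on the right is at least 1: the
  series defining the moment telescope and are thus bounded, whence the supremum dominates the
  single term with \<open>s = 1\<close>, \<open>k = 0\<close>.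
\<close>

lemma sigmoidal_mono_bounds:
  assumes "sigmoidal \<eta>" "mono \<eta>"
  shows "0 \<le> \<eta> x" "\<eta> x \<le> 1"
proof -
  have lim: "(\<eta> \<longlongrightarrow> 0) at_bot" "(\<eta> \<longlongrightarrow> 1) at_top"
    using assms(1) by (auto simp: sigmoidal_def)
  have "\<forall>\<^sub>F y in at_bot. \<eta> y \<le> \<eta> x"
    using eventually_le_at_bot[of x] by eventually_elim (use assms(2) in \<open>auto dest: monoD\<close>)
  then show "0 \<le> \<eta> x"
    by (rule tendsto_upperbound[OF lim(1)]) simp
  have "\<forall>\<^sub>F y in at_top. \<eta> x \<le> \<eta> y"
    using eventually_ge_at_top[of x] by eventually_elim (use assms(2) in \<open>auto dest: monoD\<close>)
  then show "\<eta> x \<le> 1"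
    by (rule tendsto_lowerbound[OF lim(2)]) simp
qed

lemma activation_nonneg:
  assumes "mono \<eta>"
  shows "0 \<le> activation \<eta> x"
  using monoD[OF assms, of "x - 1" "x + 1"] by (simp add: activation_def)

text \<open>Each term is half a difference of \<open>\<eta>\<close> over a step of length 2, so the
  telescoping leaves two values at each end instead of one.\<close>

lemma sum_activation_shift:
  "(\<Sum>k=-int N..int N. activation \<eta> (s - of_int k)) =
     (\<eta> (s + N + 1) + \<eta> (s + N) - \<eta> (s - N) - \<eta> (s - N - 1)) / 2"
proof (induction N)
  case 0
  then show ?case by (simp add: activation_def)
next
  case (Suc N)
  have "{-int (Suc N)..int (Suc N)} = insert (-int (Suc N)) (insert (int (Suc N)) {-int N..int N})"
    by auto
  then have "(\<Sum>k=-int (Suc N)..int (Suc N). activation \<eta> (s - of_int k)) =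
      activation \<eta> (s + real (Suc N)) + (activation \<eta> (s - real (Suc N)) +
        (\<Sum>k=-int N..int N. activation \<eta> (s - of_int k)))"
    by (simp add: algebra_simps)
  then show ?case
    unfolding Suc by (simp add: activation_def algebra_simps add_divide_distrib diff_divide_distrib)
qed

text \<open>After telescoping, two values in [0, 1] are added, two are subtracted and the result is
  halved, so every finite partial sum is at most 1, uniformly in the shift.\<close>

lemma activation_moment0_ge:
  assumes "sigmoidal \<eta>" "mono \<eta>"
  shows "activation \<eta> x \<le> discrete_moment0 (activation \<eta>)"
proof -
  have fin_le: "(\<Sum>k\<in>F. \<bar>activation \<eta> (s - of_int k)\<bar>) \<le> 1" if fin: "finite F" for F and s :: real
  proof -
    obtain N where N: "F \<subseteq> {-int N..int N}"
    proof
      show "F \<subseteq> {-int (nat (\<Sum>k\<in>F. \<bar>k\<bar>))..int (nat (\<Sum>k\<in>F. \<bar>k\<bar>))}"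
      proof
        fix k assume "k \<in> F"
        then have "\<bar>k\<bar> \<le> (\<Sum>k\<in>F. \<bar>k\<bar>)"
          using fin by (intro member_le_sum) auto
        then show "k \<in> {-int (nat (\<Sum>k\<in>F. \<bar>k\<bar>))..int (nat (\<Sum>k\<in>F. \<bar>k\<bar>))}" by auto
      qed
    qed
    have "(\<Sum>k\<in>F. \<bar>activation \<eta> (s - of_int k)\<bar>) = (\<Sum>k\<in>F. activation \<eta> (s - of_int k))"
      using activation_nonneg[OF assms(2)] by simp
    also have "\<dots> \<le> (\<Sum>k=-int N..int N. activation \<eta> (s - of_int k))"
      using N activation_nonneg[OF assms(2)] by (intro sum_mono2) auto
    also have "\<dots> \<le> 1"
      unfolding sum_activation_shift
      using sigmoidal_mono_bounds[OF assms, of "s + N + 1"] sigmoidal_mono_bounds[OF assms, of "s + N"]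
        sigmoidal_mono_bounds[OF assms, of "s - N"] sigmoidal_mono_bounds[OF assms, of "s - N - 1"]
      by simp
    finally show ?thesis .
  qed
  \<comment> \<open>Without convergence \<open>infsum\<close> would default to 0 and the single term
    could not be compared with it.\<close>
  have summable: "(\<lambda>k::int. \<bar>activation \<eta> (s - of_int k)\<bar>) summable_on UNIV" for s
    by (rule nonneg_bdd_above_summable_on) (auto intro!: bdd_aboveI2[where M = 1] fin_le)
  have "activation \<eta> x \<le> (\<Sum>\<^sub>\<infinity>k\<in>{0::int}. \<bar>activation \<eta> (x - of_int k)\<bar>)"
    by simp
  also have "\<dots> \<le> (\<Sum>\<^sub>\<infinity>k::int. \<bar>activation \<eta> (x - of_int k)\<bar>)"
    by (rule infsum_mono_neutral) (use summable in auto)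
  also have "\<dots> \<le> discrete_moment0 (activation \<eta>)"
    unfolding discrete_moment0_def
    by (rule cSUP_upper) (auto intro!: bdd_aboveI2[where M = 1] infsum_le_finite_sums summable fin_le)
  finally show ?thesis .
qed

text \<open>Both points on the right lie in [0, 2], symmetric about 1. Comparing each with the chord
  over [0, 2] gives weights that add up to 1 at either endpoint.\<close>

lemma concave_on_nonneg_sum_ge:
  fixes g :: "real \<Rightarrow> real"
  assumes "concave_on {0..} g" "0 \<le> x" "x \<le> 1"
  shows "g 0 + g 2 \<le> g (1 - x) + g (1 + x)"
proof -
  have *: "(1 - u) * g 0 + u * g 2 \<le> g (2 * u)" if "0 \<le> u" "u \<le> 1" for u
    using concave_onD[OF assms(1), of u 0 2] that by (simp add: mult.commute)
  have "(1 + x) / 2 * g 0 + (1 - x) / 2 * g 2 \<le> g (1 - x)"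
    using *[of "(1 - x) / 2"] assms(2,3) by (simp add: diff_divide_distrib add_divide_distrib)
  moreover have "(1 - x) / 2 * g 0 + (1 + x) / 2 * g 2 \<le> g (1 + x)"
    using *[of "(1 + x) / 2"] assms(2,3) by (simp add: diff_divide_distrib add_divide_distrib)
  ultimately show ?thesis
    by (simp add: field_simps)
qed

text \<open>By the symmetry, twice the activation at \<open>x\<close> is
  \<open>\<eta> (1 - x) + \<eta> (1 + x) - 1\<close>, which is even in \<open>x\<close>. Concavity
  makes it smallest on [-1, 1] at the endpoints.\<close>

lemma activation_ge_one:
  assumes odd: "\<And>s. \<eta> (- s) - 1 / 2 = - (\<eta> s - 1 / 2)"
    and conc: "concave_on {0..} \<eta>" and x: "\<bar>x\<bar> \<le> 1"
  shows "activation \<eta> 1 \<le> activation \<eta> x"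
proof -
  have refl: "\<eta> (x - 1) = 1 - \<eta> (1 - x)" "\<eta> 0 = 1 / 2"
    using odd[of "1 - x"] odd[of 0] by simp_all
  have "\<eta> 0 + \<eta> 2 \<le> \<eta> (1 - \<bar>x\<bar>) + \<eta> (1 + \<bar>x\<bar>)"
    using concave_on_nonneg_sum_ge[OF conc] x by simp
  also have "\<dots> = \<eta> (1 - x) + \<eta> (1 + x)"
    by (cases "0 \<le> x") auto
  finally show ?thesis
    using refl by (simp add: activation_def add.commute)
qed

text \<open>Otherwise \<open>\<eta>\<close> does not rise from 0 to 2, and concavity keeps it at
  most 1/2 beyond 2, against the limit 1.\<close>

lemma activation_one_pos:
  assumes "sigmoidal \<eta>" and odd: "\<And>s. \<eta> (- s) - 1 / 2 = - (\<eta> s - 1 / 2)"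
    and conc: "concave_on {0..} \<eta>"
  shows "0 < activation \<eta> 1"
proof (rule ccontr)
  have half: "\<eta> 0 = 1 / 2"
    using odd[of 0] by simp
  assume "\<not> 0 < activation \<eta> 1"
  then have two: "\<eta> 2 \<le> 1 / 2"
    using half by (simp add: activation_def)
  have le: "\<eta> t \<le> 1 / 2" if "2 < t" for t
  proof -
    \<comment> \<open>The point 2 is the convex combination of 0 and \<open>t\<close> with weight
      \<open>2 / t\<close> on \<open>t\<close>.\<close>
    have "(1 - 2 / t) * \<eta> 0 + 2 / t * \<eta> t \<le> \<eta> 2"
      using concave_onD[OF conc, of "2 / t" 0 t] that by simp
    then have "2 / t * \<eta> t \<le> 2 / t * (1 / 2)"
      using two half by (simp add: left_diff_distrib diff_divide_distrib)
    then show ?thesis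
      using that by (subst (asm) mult_le_cancel_left_pos) auto
  qed
  have "\<forall>\<^sub>F t in at_top. \<eta> t \<le> 1 / 2"
    using eventually_gt_at_top[of 2] by eventually_elim (use le in auto)
  moreover have "(\<eta> \<longlongrightarrow> 1) at_top"
    using assms(1) by (simp add: sigmoidal_def)
  ultimately have "(1::real) \<le> 1 / 2"
    by (intro tendsto_upperbound[of \<eta> 1 at_top "1 / 2"]) auto
  then show False by simp
qed

lemma finite_grid_index: "finite (grid_index a b n)"
proof -
  have "vec_nth ` grid_index a b n \<subseteq> (\<Pi>\<^sub>E i\<in>UNIV. {\<lceil>real n * a $ i\<rceil>..\<lfloor>real n * b $ i\<rfloor>})"
    by (auto simp: grid_index_def PiE_def)
  moreover have "finite (\<Pi>\<^sub>E i\<in>UNIV. {\<lceil>real n * a $ i\<rceil>..\<lfloor>real n * b $ i\<rfloor>})"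
    by (intro finite_PiE) auto
  ultimately show ?thesis
    by (metis finite_subset finite_imageD injI vec_nth_inject inj_on_subset top_greatest)
qed

text \<open>
  The integer part of a coordinate of \<open>n s\<close> may fall below the grid; then the smallest admissible
  index is still within distance one.
\<close>
lemma grid_index_near:
  assumes "s \<in> cbox a b" "grid_index a b n \<noteq> {}"
  obtains k where "k \<in> grid_index a b n" "\<And>i. \<bar>real n * s $ i - of_int (k $ i)\<bar> \<le> 1"
proof
  define k where "k = (\<chi> i. max \<lfloor>real n * s $ i\<rfloor> \<lceil>real n * a $ i\<rceil>)"
  have s: "real n * a $ i \<le> real n * s $ i" "real n * s $ i \<le> real n * b $ i" for i
    using assms(1) by (auto simp: mem_box_cart intro: mult_left_mono)
  \<comment> \<open>Nonemptiness of the grid enters here: it keeps the maximum in \<open>k\<close>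
    below the upper index bound.\<close>
  have "\<lceil>real n * a $ i\<rceil> \<le> \<lfloor>real n * b $ i\<rfloor>" for i
    using assms(2) by (auto simp: grid_index_def intro: order_trans)
  then show "k \<in> grid_index a b n"
    using s(2) by (auto simp: grid_index_def k_def intro: floor_mono)
  \<comment> \<open>If the ceiling exceeds the floor, then
    \<open>n a \<le> n s < \<lceil>n a\<rceil> < n a + 1\<close> in that coordinate.\<close>
  show "\<bar>real n * s $ i - of_int (k $ i)\<bar> \<le> 1" for i
    using s(1)[of i] by (simp add: k_def max_def) linarith
qed

theorem lemma3p3:
  fixes \<eta> :: "real \<Rightarrow> real" and a b s :: "real ^ 'd" and \<alpha> \<beta> :: real
    and U :: "(real ^ 'd) set" and f :: "real ^ 'd \<Rightarrow> real" and n :: nat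
  assumes "admissible_sigmoidal \<eta>"
    and "0 \<le> \<alpha>" and "\<alpha> \<le> \<beta>"
    and "bounded_cont_extension a b \<alpha> \<beta> U f"
    and "s \<in> cbox a b"
    and "1 \<le> n" and "grid_index a b n \<noteq> {}"
  shows "stancu_denom \<eta> a b n s \<noteq> 0 \<and>
    \<bar>stancu_op \<eta> a b \<alpha> \<beta> n f s\<bar>
      \<le> (discrete_moment0 (activation \<eta>) / activation \<eta> 1) ^ CARD('d) * (SUP x\<in>U. \<bar>f x\<bar>)"
proof -
  let ?G = "grid_index a b n" and ?S = "SUP x\<in>U. \<bar>f x\<bar>"
  let ?C = "(discrete_moment0 (activation \<eta>) / activation \<eta> 1) ^ CARD('d)"
  have sig: "sigmoidal \<eta>" and mono: "mono \<eta>" and conc: "concave_on {0..} \<eta>"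
    and odd: "\<And>s. \<eta> (- s) - 1 / 2 = - (\<eta> s - 1 / 2)"
    using assms(1) by (auto simp: admissible_sigmoidal_def)
  have nodes: "stancu_node \<alpha> \<beta> n k \<in> U" if "k \<in> ?G" for k
    using assms(4,6) that by (auto simp: bounded_cont_extension_def)
  have bdd: "bdd_above ((\<lambda>x. \<bar>f x\<bar>) ` U)"
    using assms(4) by (auto simp: bounded_cont_extension_def bounded_iff bdd_above_def)
  have pos: "0 < activation \<eta> 1"
    by (rule activation_one_pos[OF sig odd conc])
  have kernel_nonneg: "0 \<le> kernel \<eta> n s k" for k
    by (simp add: kernel_def activation_prod_def prod_nonneg activation_nonneg[OF mono])
  obtain k where k: "k \<in> ?G" "\<And>i. \<bar>real n * s $ i - of_int (k $ i)\<bar> \<le> 1"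
    using grid_index_near[OF assms(5,7)] by blast
  have "0 < activation \<eta> (real n * s $ i - of_int (k $ i))" for i
    using activation_ge_one[OF odd conc k(2)[of i]] pos by linarith
  then have "0 < kernel \<eta> n s k"
    by (simp add: kernel_def activation_prod_def prod_pos)
  then have denom: "0 < stancu_denom \<eta> a b n s"
    unfolding stancu_denom_def
    using k(1) kernel_nonneg finite_grid_index by (intro sum_pos2[where i = k]) auto
  have f_le: "\<bar>f (stancu_node \<alpha> \<beta> n k)\<bar> \<le> ?S" if "k \<in> ?G" for k
    using cSUP_upper[OF nodes[OF that] bdd] .
  have "\<bar>\<Sum>k\<in>?G. kernel \<eta> n s k * f (stancu_node \<alpha> \<beta> n k)\<bar> \<le> (\<Sum>k\<in>?G. kernel \<eta> n s k * ?S)"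
    by (rule order_trans[OF sum_abs])
      (auto simp: abs_mult kernel_nonneg intro!: sum_mono mult_left_mono f_le)
  also have "\<dots> = ?S * stancu_denom \<eta> a b n s"
    by (simp add: stancu_denom_def sum_distrib_left mult.commute)
  finally have "\<bar>stancu_op \<eta> a b \<alpha> \<beta> n f s\<bar> \<le> ?S"
    using denom by (simp add: stancu_op_def pos_divide_le_eq)
  also have "?S \<le> ?C * ?S"
  proof -
    have "1 \<le> discrete_moment0 (activation \<eta>) / activation \<eta> 1"
      using activation_moment0_ge[OF sig mono, of 1] pos by simp
    then have "1 \<le> ?C"
      by (rule one_le_power)
    \<comment> \<open>The node of the index \<open>k\<close> found above lies in \<open>U\<close>,
      so the supremum dominates an absolute value.\<close>
    moreover have "0 \<le> ?S"
      using f_le[OF k(1)] by linarith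
    ultimately show ?thesis
      using mult_right_mono[of 1 ?C ?S] by simp
  qed
  finally show ?thesis
    using denom by simp
qed

end
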